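(* For every ecumenical formula of the form $A^c$ (with $A^i$ its intuitionistic counterpart), every ecumenical formula $B$ and every atomic system $S$, $\Vdash^L_S \big(((A^i\to B)^i\to A^i)^i\to A^c\big)^i$.
   Context: Basic setting. Let $\mathsf{At}$ be a countably infinite set of atomic propositions and $\mathsf{At}_\bot=\mathsf{At}\cup\{\bot\}$. An atomic rule has the form "from premises $p_1,\dots,p_n$ ($n\ge 0$) infer $p$", with $p_j,p\in\mathsf{At}_\bot$, where the derivation of each premise may discharge a set of basic sentences. An atomic system $S$ is a set of atomic rules; $S\subseteq S'$ ($S'$ extends $S$) if $S'$ contains all rules of $S$. $\Delta\vdash_S p$ means there is a natural-deduction derivation using only rules of $S$ with conclusion $p$ and undischarged assumptions in $\Delta$ (so $p\vdash_S p$). $S$ is consistent if $\nvdash_S\bot$. Standing convention: all atomic systems (including all extensions quantified over) are required to be consistent. Ecumenical formulas: $p^i,p^c$ for $p\in\mathsf{At}_\bot$; $(A\wedge B)^x,(A\vee B)^x,(A\to B)^x$ for $x\in\{i,c\}$. $\bot$ denotes $\bot^i$; for $X^c$, $X^i$ is the same construction with outer superscript $i$. Weak validity (by simultaneous recursion): (1) $\Vdash^L_S p^i$ iff $\vdash_S p$ ($p\in\mathsf{At}_\bot$); (2) $\Vdash^L_S p^c$ iff $p\nvdash_S\bot$; (3) for non-atomic $X$, $\Vdash^L_S X^c$ iff $X^i\nVdash^L_S\bot$; (4) $\Vdash^L_S(A\wedge B)^i$ iff $\Vdash^L_S A$ and $\Vdash^L_S B$; (5) $\Vdash^L_S(A\to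 B)^i$ iff $A\Vdash^G_S B$; (6) $\Vdash^L_S(A\vee B)^i$ iff for all $S'\supseteq S$ and all $p\in\mathsf{At}_\bot$, if $A\Vdash^L_{S'}p^i$ and $B\Vdash^L_{S'}p^i$ then $\Vdash^L_{S'}p^i$; (7) for nonempty $\Gamma$, $\Gamma\Vdash^L_S A$ iff for all $S'\supseteq S$, if $\Vdash^L_{S'}B$ for all $B\in\Gamma$ then $\Vdash^L_{S'}A$; (8) $\Gamma\Vdash^G_S A$ iff for all $S'\supseteq S$: if $\Vdash^L_{S''}B$ for all $B\in\Gamma$ and all $S''\supseteq S'$, then $\Vdash^L_{S''}A$ for all $S''\supseteq S'$. *)

theory Defs
  imports "HOL-Library.Countable" "HOL-Library.Infinite_Typeclass"
begin

section \<open>Atomic systems\<close>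

datatype 'a basic = Atom 'a | Falsum

text \<open>A rule \<open>([(\<Theta>\<^sub>1, p\<^sub>1), \<dots>, (\<Theta>\<^sub>n, p\<^sub>n)], p)\<close> infers \<open>p\<close> from the premises
  \<open>p\<^sub>1, \<dots>, p\<^sub>n\<close>, where the derivation of \<open>p\<^sub>j\<close> may discharge assumptions in \<open>\<Theta>\<^sub>j\<close>.\<close>

type_synonym 'a rule = "('a basic set \<times> 'a basic) list \<times> 'a basic"
type_synonym 'a system = "'a rule set"

text \<open>Natural deduction in sequent style: \<open>derives S \<Delta> p\<close> holds iff \<open>p\<close> has a derivation
  in \<open>S\<close> whose undischarged assumptions all lie in \<open>\<Delta>\<close>.\<close>

inductive derives :: "'a system \<Rightarrow> 'a basic set \<Rightarrow> 'a basic \<Rightarrow> bool" for S where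
  assumption: "p \<in> \<Delta> \<Longrightarrow> derives S \<Delta> p"
| rule_app: "(ps, p) \<in> S \<Longrightarrow> (\<And>\<Theta> q. (\<Theta>, q) \<in> set ps \<Longrightarrow> derives S (\<Delta> \<union> \<Theta>) q)
    \<Longrightarrow> derives S \<Delta> p"

definition consistent :: "'a system \<Rightarrow> bool" where
  "consistent S \<longleftrightarrow> \<not> derives S {} Falsum"

text \<open>Only consistent extensions count, since every atomic system is required to be consistent.\<close>

definition extends :: "'a system \<Rightarrow> 'a system \<Rightarrow> bool" where
  "extends S' S \<longleftrightarrow> S \<subseteq> S' \<and> consistent S'"


section \<open>Ecumenical formulas\<close>

text \<open>A formula is a construction \<open>X\<close> together with its outer superscript, so that
  \<open>X\<^sup>c\<close> and \<open>X\<^sup>i\<close> are \<open>Ecu X Cl\<close> and \<open>Ecu X In\<close>.\<close>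

datatype superscript = In | Cl

datatype 'a form = Ecu "'a construction" superscript
  and 'a construction =
    Basic "'a basic"
  | Conj "'a form" "'a form"
  | Disj "'a form" "'a form"
  | Impl "'a form" "'a form"

abbreviation intu :: "'a construction \<Rightarrow> 'a form" ("_\<^sup>i" [1000] 1000) where
  "X\<^sup>i \<equiv> Ecu X In"

abbreviation clas :: "'a construction \<Rightarrow> 'a form" ("_\<^sup>c" [1000] 1000) where
  "X\<^sup>c \<equiv> Ecu X Cl"


section \<open>Weak validity\<close>

text \<open>The two consequence relations, relative to a notion \<open>V S A\<close> of validity of \<open>A\<close> in \<open>S\<close>.
  They are tied to weak validity itself by the recursion defining \<open>valid\<close>.\<close>

definition local_cons ::
  "('a system \<Rightarrow> 'a form \<Rightarrow> bool) \<Rightarrow> 'a form set \<Rightarrow> 'a system \<Rightarrow> 'a form \<Rightarrow> bool" where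
  "local_cons V \<Gamma> S A \<longleftrightarrow>
     (if \<Gamma> = {} then V S A
      else \<forall>S'. extends S' S \<longrightarrow> (\<forall>B\<in>\<Gamma>. V S' B) \<longrightarrow> V S' A)"

definition global_cons ::
  "('a system \<Rightarrow> 'a form \<Rightarrow> bool) \<Rightarrow> 'a form set \<Rightarrow> 'a system \<Rightarrow> 'a form \<Rightarrow> bool" where
  "global_cons V \<Gamma> S A \<longleftrightarrow>
     (\<forall>S'. extends S' S \<longrightarrow>
        (\<forall>B\<in>\<Gamma>. \<forall>S''. extends S'' S' \<longrightarrow> V S'' B) \<longrightarrow>
        (\<forall>S''. extends S'' S' \<longrightarrow> V S'' A))"

lemma local_cons_cong [fundef_cong]:
  assumes "\<Gamma> = \<Gamma>'" "S = S'" "A = A'" "\<And>T B. B \<in> insert A' \<Gamma>' \<Longrightarrow> V T B = V' T B"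
  shows "local_cons V \<Gamma> S A = local_cons V' \<Gamma>' S' A'"
  using assms unfolding local_cons_def by auto

lemma global_cons_cong [fundef_cong]:
  assumes "\<Gamma> = \<Gamma>'" "S = S'" "A = A'" "\<And>T B. B \<in> insert A' \<Gamma>' \<Longrightarrow> V T B = V' T B"
  shows "global_cons V \<Gamma> S A = global_cons V' \<Gamma>' S' A'"
  using assms unfolding global_cons_def by auto

primrec weight :: "'a form \<Rightarrow> nat" and cweight :: "'a construction \<Rightarrow> nat" where
  "weight (Ecu X x) = cweight X + (case x of In \<Rightarrow> 0 | Cl \<Rightarrow> 1)"
| "cweight (Basic p) = 0"
| "cweight (Conj A B) = Suc (weight A + weight B)"
| "cweight (Disj A B) = Suc (weight A + weight B)"
| "cweight (Impl A B) = Suc (weight A + weight B)"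

function valid :: "'a system \<Rightarrow> 'a form \<Rightarrow> bool" where
  "valid S (Basic p)\<^sup>i \<longleftrightarrow> derives S {} p"
| "valid S (Basic p)\<^sup>c \<longleftrightarrow> \<not> derives S {p} Falsum"
| "valid S (Conj A B)\<^sup>c \<longleftrightarrow> \<not> local_cons valid {(Conj A B)\<^sup>i} S (Basic Falsum)\<^sup>i"
| "valid S (Disj A B)\<^sup>c \<longleftrightarrow> \<not> local_cons valid {(Disj A B)\<^sup>i} S (Basic Falsum)\<^sup>i"
| "valid S (Impl A B)\<^sup>c \<longleftrightarrow> \<not> local_cons valid {(Impl A B)\<^sup>i} S (Basic Falsum)\<^sup>i"
| "valid S (Conj A B)\<^sup>i \<longleftrightarrow> valid S A \<and> valid S B"
| "valid S (Impl A B)\<^sup>i \<longleftrightarrow> global_cons valid {A} S B"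
| "valid S (Disj A B)\<^sup>i \<longleftrightarrow>
     (\<forall>S' p. extends S' S \<longrightarrow>
        local_cons valid {A} S' (Basic p)\<^sup>i \<longrightarrow> local_cons valid {B} S' (Basic p)\<^sup>i \<longrightarrow>
        valid S' (Basic p)\<^sup>i)"
  by pat_completeness auto
termination
  by (relation "measure (\<lambda>(S, A). weight A)") auto

end

theory Submission
  imports Defs
begin

text \<open>If \<open>A\<^sup>c\<close> fails in \<open>S\<close>, then no extension of \<open>S\<close> validates \<open>A\<^sup>i\<close>; for basic \<open>A\<close> this is the
  admissibility of cut. Hence \<open>A\<^sup>i \<rightarrow> B\<close> holds vacuously in every extension of \<open>S\<close>, so the premise
  \<open>(A\<^sup>i \<rightarrow> B) \<rightarrow> A\<^sup>i\<close> would make \<open>A\<^sup>i\<close> valid in \<open>S\<close> itself, a contradiction.\<close>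

lemma derives_mono:
  assumes "derives S \<Delta> p" "S \<subseteq> S'" "\<Delta> \<subseteq> \<Delta>'"
  shows "derives S' \<Delta>' p"
  using assms(1,3)
proof (induction arbitrary: \<Delta>' rule: derives.induct)
  case (assumption p \<Delta>)
  then show ?case by (auto intro: derives.assumption)
next
  case (rule_app ps p \<Delta>)
  show ?case
  proof (rule derives.rule_app)
    show "(ps, p) \<in> S'" using rule_app.hyps(1) assms(2) by blast
    show "derives S' (\<Delta>' \<union> \<Theta>) q" if "(\<Theta>, q) \<in> set ps" for \<Theta> q
      using rule_app.IH[OF that] rule_app.prems by blast
  qed
qed

text \<open>Induction on the derivation of \<open>p\<close>, with \<open>\<Delta>\<close>
  generalized because each premise of a rule adds its discharged set \<open>\<Theta>\<close> to the
  context.\<close>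

lemma derives_cut:
  assumes "derives S \<Gamma> p" "\<And>q. q \<in> \<Gamma> \<Longrightarrow> derives S \<Delta> q"
  shows "derives S \<Delta> p"
  using assms
proof (induction arbitrary: \<Delta> rule: derives.induct)
  case (assumption p \<Gamma>)
  then show ?case by blast
next
  case (rule_app ps p \<Gamma>)
  show ?case
  proof (rule derives.rule_app[OF rule_app.hyps(1)])
    fix \<Theta> q assume "(\<Theta>, q) \<in> set ps"
    then show "derives S (\<Delta> \<union> \<Theta>) q"
    proof (rule rule_app.IH)
      show "derives S (\<Delta> \<union> \<Theta>) r" if "r \<in> \<Gamma> \<union> \<Theta>" for r
        using that rule_app.prems by (auto intro: derives.assumption derives_mono)
    qed
  qed
qed

lemma extends_refl: "consistent S \<Longrightarrow> extends S S"
  by (simp add: extends_def)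

lemma extends_trans: "extends T S' \<Longrightarrow> extends S' S \<Longrightarrow> extends T S"
  by (auto simp: extends_def)

lemma not_valid_clas_imp_not_valid_intu:
  assumes "\<not> valid S A\<^sup>c" "extends T S"
  shows "\<not> valid T A\<^sup>i"
proof (cases A)
  case (Basic p)
  then have "derives T {p} Falsum"
    using assms derives_mono[of S "{p}" Falsum T] by (simp add: extends_def)
  then have "\<not> derives T {} p"
    using assms(2) derives_cut[of T "{p}" Falsum "{}"] by (auto simp: extends_def consistent_def)
  then show ?thesis using Basic by simp
\<comment> \<open>For compound \<open>A\<close>, failure of \<open>A\<^sup>c\<close> in
  \<open>S\<close> means that \<open>A\<^sup>i\<close> locally entails falsum over \<open>S\<close>,
  and the consistent \<open>T\<close> does not derive falsum.\<close>
qed (use assms in \<open>auto simp: local_cons_def extends_def consistent_def simp del: valid.simps(6-8)\<close>)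

theorem theorem9:
  fixes A :: "('a :: {countable, infinite}) construction"
    and B :: "'a form"
    and S :: "'a system"
  assumes "consistent S"
  shows "valid S (Impl (Impl (Impl A\<^sup>i B)\<^sup>i A\<^sup>i)\<^sup>i A\<^sup>c)\<^sup>i"
proof -
  have "valid T A\<^sup>c" if T: "consistent T" and peirce: "valid T (Impl (Impl A\<^sup>i B)\<^sup>i A\<^sup>i)\<^sup>i" for T
  proof (rule ccontr)
    assume "\<not> valid T A\<^sup>c"
    then have no_A: "\<not> valid U A\<^sup>i" if "extends U T" for U
      using not_valid_clas_imp_not_valid_intu that by blast
    have "valid U (Impl A\<^sup>i B)\<^sup>i" if "extends U T" for U
    proof -
      \<comment> \<open>\<open>W\<close> is among its own extensions, so the antecedent of the
        global consequence fails at every \<open>W\<close>.\<close>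
      have "extends W W \<and> \<not> valid W A\<^sup>i" if "extends W U" for W
        using that \<open>extends U T\<close> no_A extends_trans by (auto simp: extends_def)
      then show ?thesis by (auto simp: global_cons_def)
    qed
    moreover have "extends T T" using T by (rule extends_refl)
    ultimately have "valid T A\<^sup>i"
      using peirce by (simp add: global_cons_def[of valid "{(Impl A\<^sup>i B)\<^sup>i}"])
    then show False using no_A \<open>extends T T\<close> by blast
  qed
  \<comment> \<open>Preservation of validity at each single consistent system yields the global
    consequence.\<close>
  then show ?thesis
    by (auto simp: global_cons_def[of valid "{(Impl (Impl A\<^sup>i B)\<^sup>i A\<^sup>i)\<^sup>i}"] extends_def
        simp del: valid.simps(1-6,8))
qed

end
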